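(* For each $i\in N$, let $f_i:X\times X\times X_i\to 2^{Y_i}$ be a correspondence with nonempty, closed values. For each $i\in N$, suppose that: a) $A_i,F_i$ have nonempty, convex values and open lower sections; b) $f_i(\cdot,x_i,\cdot,y_i,\cdot):X_{-i}\times X_{-i}\times X_i\to 2^{Y_i}$ is upper semicontinuous for each $(x_i,y_i)\in X_i\times X_i$; c) $C_i$ is an upper semicontinuous correspondence; d) for each $(x_{-i},y_{-i})\in X_{-i}\times X_{-i}$ there exists $(x_i,y_i)\in A_i(x_{-i})\times F_i(y_{-i})$ such that $f_i(x,y,u_i)\cap(-C_i(x_{-i}))=\emptyset$ for each $u_i\in\overline{A}_i(x_{-i})$; e) for each $(x_{-i},y_{-i},u_i)\in X_{-i}\times X_{-i}\times X_i$, $f_i(x_{-i},\cdot,y_{-i},\cdot,u_i):X_i\times X_i\to 2^{Y_i}$ is $(-C_i(x_{-i}))$-quasi-convex-like. Then there exists a pair $(x^*,y^* )\in X\times X$ such that for each $i\in N$, $x_i^*\in A_i(x^*_{-i})$, $y_i^*\in F_i(y^*_{-i})$ and $f_i(x^*,y^*,u_i)\cap(-\mathrm{int}\,C_i(x^*_{-i}))=\emptyset$ for each $u_i\in A_i(x^*_{-i})$.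
   Context: Setting. $N=\{1,\dots,n\}$ is finite. For each $i\in N$, $X_i$ is a nonempty convex compact subset of a Hausdorff locally convex space $E_i$ and $Y_i$ is a topological vector space. $X=\prod_{i\in N}X_i$, $X_{-i}=\prod_{j\neq i}X_j$; for $x\in X$ write $x=(x_{-i},x_i)$, and similarly $y=(y_{-i},y_i)$; $f_i(x,y,u_i)$ is also written $f_i(x_{-i},x_i,y_{-i},y_i,u_i)$. A correspondence is a set-valued map. For each $i\in N$, $A_i,F_i:X_{-i}\to 2^{X_i}$ and $C_i:X_{-i}\to 2^{Y_i}$ are correspondences with nonempty values, and for each $x_{-i}\in X_{-i}$, $C_i(x_{-i})$ is a proper, closed and convex cone with $\mathrm{int}\,C_i(x_{-i})\neq\emptyset$. Definitions. For a correspondence $T:U\to 2^V$ between topological spaces: $T$ has open lower sections if $\{u\in U:v\in T(u)\}$ is open for each $v\in V$; $T$ is upper semicontinuous if for each $u\in U$ and each open $O\supset T(u)$ there is an open neighborhood $U'$ of $u$ with $T(u')\subset O$ for all $u'\in U'$; $\overline{T}(u)=\{v\in V:(u,v)\in\mathrm{cl}_{U\times V}\,\mathrm{Gr}\,T\}$. For $K$ convex, $Y$ a topological vector space and $D\subset Y$, a correspondence $G:K\to 2^Y$ is $D$-quasi-convex-like if for any $k_1,k_2\in K$ and $\lambda\in[0,1]$ either $G(\lambda k_1+(1-\lambda)k_2)\subseteq G(k_1)-D$ or $G(\lambda k_1+(1-\lambda)k_2)\subseteq G(k_2)-D$. *)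

theory Defs
  imports "HOL-Analysis.Analysis"
begin

text \<open>
  A topological vector space is given by a topology whose carrier \<open>topspace T\<close> is a linear
  subspace of an ambient real vector space without topology. Different indices can thus carry
  different spaces \<open>E i\<close>, and no generality is lost: any family of real vector spaces embeds
  linearly into its direct sum. The Hausdorff property is not part of the definition.
\<close>

definition tvs :: "'a::real_vector topology \<Rightarrow> bool" where
  "tvs T \<longleftrightarrow>
     subspace (topspace T) \<and>
     continuous_map (prod_topology T T) T (\<lambda>(x, y). x + y) \<and>
     continuous_map (prod_topology euclideanreal T) T (\<lambda>(c, x). c *\<^sub>R x)"

text \<open>By translation it suffices to ask for a base of convex neighbourhoods at the origin.\<close>

definition locally_convex_tvs :: "'a::real_vector topology \<Rightarrow> bool" where
  "locally_convex_tvs T \<longleftrightarrow>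
     tvs T \<and>
     (\<forall>U. openin T U \<and> 0 \<in> U \<longrightarrow> (\<exists>V. openin T V \<and> convex V \<and> 0 \<in> V \<and> V \<subseteq> U))"

text \<open>
  A correspondence from \<open>U\<close> to \<open>V\<close> is a set-valued function, of which only the values at points of
  \<open>topspace U\<close> matter.
\<close>

definition correspondence :: "'u topology \<Rightarrow> 'v topology \<Rightarrow> ('u \<Rightarrow> 'v set) \<Rightarrow> bool" where
  "correspondence U V T \<longleftrightarrow> (\<forall>u\<in>topspace U. T u \<subseteq> topspace V)"

definition open_lower_sections :: "'u topology \<Rightarrow> 'v topology \<Rightarrow> ('u \<Rightarrow> 'v set) \<Rightarrow> bool" where
  "open_lower_sections U V T \<longleftrightarrow> (\<forall>v\<in>topspace V. openin U {u \<in> topspace U. v \<in> T u})"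

definition upper_semicontinuous :: "'u topology \<Rightarrow> 'v topology \<Rightarrow> ('u \<Rightarrow> 'v set) \<Rightarrow> bool" where
  "upper_semicontinuous U V T \<longleftrightarrow>
     (\<forall>u\<in>topspace U. \<forall>W. openin V W \<and> T u \<subseteq> W \<longrightarrow>
        (\<exists>U'. openin U U' \<and> u \<in> U' \<and> (\<forall>u'\<in>U'. T u' \<subseteq> W)))"

definition corr_graph :: "'u topology \<Rightarrow> 'v topology \<Rightarrow> ('u \<Rightarrow> 'v set) \<Rightarrow> ('u \<times> 'v) set" where
  "corr_graph U V T = {(u, v). u \<in> topspace U \<and> v \<in> topspace V \<and> v \<in> T u}"

definition corr_closure :: "'u topology \<Rightarrow> 'v topology \<Rightarrow> ('u \<Rightarrow> 'v set) \<Rightarrow> 'u \<Rightarrow> 'v set" where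
  "corr_closure U V T u =
     {v \<in> topspace V. (u, v) \<in> prod_topology U V closure_of corr_graph U V T}"

text \<open>
  \<open>A - D\<close> on sets is set difference in HOL, so the algebraic difference is written out.
\<close>

definition quasi_convex_like ::
  "'k::real_vector set \<Rightarrow> 'y::real_vector set \<Rightarrow> ('k \<Rightarrow> 'y set) \<Rightarrow> bool" where
  "quasi_convex_like K D G \<longleftrightarrow>
     (\<forall>k1\<in>K. \<forall>k2\<in>K. \<forall>t\<in>{0..1::real}.
        G (t *\<^sub>R k1 + (1 - t) *\<^sub>R k2) \<subseteq> {g - d | g d. g \<in> G k1 \<and> d \<in> D} \<or>
        G (t *\<^sub>R k1 + (1 - t) *\<^sub>R k2) \<subseteq> {g - d | g d. g \<in> G k2 \<and> d \<in> D})"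

text \<open>Properness of a cone means that it is not the whole space.\<close>

definition proper_closed_convex_cone :: "'y::real_vector topology \<Rightarrow> 'y set \<Rightarrow> bool" where
  "proper_closed_convex_cone T C \<longleftrightarrow>
     closedin T C \<and> convex C \<and> cone C \<and> C \<noteq> {} \<and> C \<noteq> topspace T"

text \<open>
  Profiles are extensional functions on the index set: \<open>prof X {1..n}\<close> is the full product and
  \<open>prof X ({1..n} - {i})\<close> the product over the indices other than \<open>i\<close>. The profile with
  components \<open>z\<close> (outside \<open>i\<close>) and \<open>a\<close> (at \<open>i\<close>) is \<open>z(i := a)\<close>.
\<close>

abbreviation prof :: "(nat \<Rightarrow> 'e set) \<Rightarrow> nat set \<Rightarrow> (nat \<Rightarrow> 'e) set" where
  "prof X I \<equiv> Pi\<^sub>E I X"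

abbreviation prof_topology ::
  "(nat \<Rightarrow> 'e topology) \<Rightarrow> (nat \<Rightarrow> 'e set) \<Rightarrow> nat set \<Rightarrow> (nat \<Rightarrow> 'e) topology" where
  "prof_topology E X I \<equiv> product_topology (\<lambda>j. subtopology (E j) (X j)) I"

end

theory Submission
  imports Defs
begin

text \<open>
  Call \<open>(a, b) \<in> A i xm \<times> F i ym\<close> acceptable for player \<open>i\<close> against the opponents' profiles
  \<open>(xm, ym)\<close> if \<open>f i (xm, a) (ym, b) u\<close> misses \<open>- C i xm\<close> for all \<open>u\<close> in the closure of \<open>A i\<close> at
  \<open>xm\<close>. A pair \<open>(x, y)\<close> in which each \<open>(x i, y i)\<close> is acceptable against the other components solves the
  problem, even with \<open>C i\<close> in place of its interior. So it suffices to find a fixed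
  point of the map that sends \<open>(x, y)\<close> to the product of the sets of acceptable pairs.

  These sets are nonempty by hypothesis, and convex because quasi-convexity modulo the cone
  transports disjointness from \<open>- C\<close> to convex combinations
  (\<open>quasi_convex_like_imp_convex_disjoint\<close>). The substance is that they have open lower sections
  (\<open>openin_acceptable_pairs\<close>). For a fixed \<open>u\<close> this amounts to disjointness of the values of two
  upper semicontinuous maps being stable under small perturbations, which may fail for closed sets in
  spaces that are not normal. It holds because one map takes cones as values: an upper semicontinuous
  family of closed convex cones with interior satisfies \<open>C x \<subseteq> C x0\<close> for all \<open>x\<close> near \<open>x0\<close>
  (\<open>upper_semicontinuous_cone_locally_contained\<close>). Uniformity over \<open>u\<close> comes from compactness of
  \<open>X i\<close> and closedness of the graph of the closure.

  A map on a compact convex product with nonempty convex values and open lower sections has a fixed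
  point (\<open>browder_product\<close>): finitely many lower sections cover, and on the simplex of weights of the
  corresponding points a partition of unity is a continuous self-map, whose Brouwer fixed point
  averages points all of which belong to the value at the average (\<open>simplex_open_cover\<close>).
\<close>

section \<open>Brouwer's theorem with a numbered set of coordinates\<close>

text \<open>
  The dimension needed below is the number of members of a finite subcover, which is known only
  inside a proof and so cannot be a type. Coordinates are therefore numbered, and all finite
  dimensions share one compact metrisable space.
\<close>

definition hilbert_cube :: "(nat \<Rightarrow> real) set" where
  "hilbert_cube = {x. \<forall>i. 0 \<le> x i \<and> x i \<le> 1}"

lemma compact_hilbert_cube: "compact hilbert_cube"
proof -
  have "hilbert_cube = (\<Pi>\<^sub>E i\<in>UNIV. {0..1})"
    by (auto simp: hilbert_cube_def)
  moreover have "compactin (product_topology (\<lambda>i::nat. euclidean) UNIV) (\<Pi>\<^sub>E i\<in>UNIV. {0..1::real})"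
    by (subst compactin_PiE) auto
  ultimately show ?thesis
    by (simp add: euclidean_product_topology)
qed

lemma tendsto_coordinatewise:
  fixes X :: "'b \<Rightarrow> 'a \<Rightarrow> real"
  shows "(X \<longlongrightarrow> l) F \<longleftrightarrow> (\<forall>i. ((\<lambda>p. X p i) \<longlongrightarrow> l i) F)"
proof -
  have "(X \<longlongrightarrow> l) F \<longleftrightarrow> limitin (product_topology (\<lambda>i. euclidean) UNIV) X l F"
    by (simp only: limitin_canonical_iff euclidean_product_topology)
  also have "\<dots> \<longleftrightarrow> (\<forall>i. ((\<lambda>p. X p i) \<longlongrightarrow> l i) F)"
    by (simp only: limitin_componentwise limitin_canonical_iff topspace_product_topology topspace_euclidean PiE_UNIV_domain) auto
  finally show ?thesis .
qed

text \<open>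
  Kuhn's combinatorial lemma, applied to ever finer grids in the first \<open>m\<close> coordinates, yields small
  cells which for every \<open>i < m\<close> have one corner where \<open>g\<close> does not decrease the \<open>i\<close>-th coordinate and
  one where \<open>g\<close> does not increase it. Along a convergent subsequence of cells all corners tend to
  the same point \<open>x\<close>, and continuity forces \<open>g x i = x i\<close>.
\<close>

lemma brouwer_coordinates:
  fixes g :: "(nat \<Rightarrow> real) \<Rightarrow> nat \<Rightarrow> real"
  assumes cont: "\<And>i. i < m \<Longrightarrow> continuous_on hilbert_cube (\<lambda>x. g x i)"
    and maps: "\<And>x. x \<in> hilbert_cube \<Longrightarrow> g x \<in> hilbert_cube"
  obtains x where "x \<in> hilbert_cube" "\<And>i. i < m \<Longrightarrow> g x i = x i"
proof -
  have lab: "\<forall>x. x \<in> hilbert_cube \<longrightarrow> g x \<in> hilbert_cube"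
    "\<forall>x. x \<in> hilbert_cube \<longrightarrow> (\<forall>i::nat. True \<longrightarrow> 0 \<le> x i \<and> x i \<le> 1)"
    using maps by (auto simp: hilbert_cube_def)
  obtain l :: "(nat \<Rightarrow> real) \<Rightarrow> nat \<Rightarrow> nat" where l:
      "\<And>x i. l x i \<le> 1"
      "\<And>x i. x \<in> hilbert_cube \<Longrightarrow> x i = 0 \<Longrightarrow> l x i = 0"
      "\<And>x i. x \<in> hilbert_cube \<Longrightarrow> x i = 1 \<Longrightarrow> l x i = 1"
      "\<And>x i. x \<in> hilbert_cube \<Longrightarrow> l x i = 0 \<Longrightarrow> x i \<le> g x i"
      "\<And>x i. x \<in> hilbert_cube \<Longrightarrow> l x i = 1 \<Longrightarrow> g x i \<le> x i"
    using kuhn_labelling_lemma'[OF lab] by blast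
  \<comment> \<open>The step number \<open>p\<close> stands for mesh \<open>1 / Suc p\<close>, which avoids a division by zero.\<close>
  define pt :: "nat \<Rightarrow> (nat \<Rightarrow> nat) \<Rightarrow> nat \<Rightarrow> real"
    where "pt p q = (\<lambda>i. if i < m then real (q i) / real (Suc p) else 0)" for p q
  have pt_cube: "pt p q \<in> hilbert_cube" if "\<forall>i<m. q i \<le> Suc p" for p q
    using that by (auto simp: pt_def hilbert_cube_def divide_le_eq_1)
  have "\<exists>q. (\<forall>i<m. q i < Suc p) \<and> (\<forall>i<m. \<exists>r s.
      (\<forall>j<m. q j \<le> r j \<and> r j \<le> q j + 1) \<and> (\<forall>j<m. q j \<le> s j \<and> s j \<le> q j + 1) \<and>
      l (pt p r) i \<noteq> l (pt p s) i)" for p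
  proof -
    have 1: "\<forall>x. (\<forall>i<m. x i \<le> Suc p) \<longrightarrow> (\<forall>i<m. l (pt p x) i = 0 \<or> l (pt p x) i = 1)"
      using l(1) by (metis less_one nat_less_le)
    have 2: "\<forall>x. (\<forall>i<m. x i \<le> Suc p) \<longrightarrow> (\<forall>i<m. x i = 0 \<longrightarrow> l (pt p x) i = 0)"
      by (intro allI impI l(2) pt_cube) (auto simp: pt_def)
    have 3: "\<forall>x. (\<forall>i<m. x i \<le> Suc p) \<longrightarrow> (\<forall>i<m. x i = Suc p \<longrightarrow> l (pt p x) i = 1)"
      by (intro allI impI l(3) pt_cube) (auto simp: pt_def)
    show ?thesis
      by (rule kuhn_lemma[OF zero_less_Suc 1 2 3]) blast
  qed
  then have "\<exists>q. \<forall>p. (\<forall>i<m. q p i < Suc p) \<and> (\<forall>i<m. \<exists>r s.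
      (\<forall>j<m. q p j \<le> r j \<and> r j \<le> q p j + 1) \<and> (\<forall>j<m. q p j \<le> s j \<and> s j \<le> q p j + 1) \<and>
      l (pt p r) i \<noteq> l (pt p s) i)"
    by (intro choice allI)
  then obtain q where q: "\<And>p i. i < m \<Longrightarrow> q p i < Suc p"
    and rs: "\<And>p i. i < m \<Longrightarrow> \<exists>r s. (\<forall>j<m. q p j \<le> r j \<and> r j \<le> q p j + 1) \<and>
      (\<forall>j<m. q p j \<le> s j \<and> s j \<le> q p j + 1) \<and> l (pt p r) i \<noteq> l (pt p s) i"
    by blast
  have corner_cube: "pt p a \<in> hilbert_cube" if "\<forall>j<m. q p j \<le> a j \<and> a j \<le> q p j + 1" for p a
  proof (intro pt_cube allI impI)
    show "a j \<le> Suc p" if j: "j < m" for j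
      using \<open>\<forall>j<m. _\<close>[rule_format, OF j] q[OF j, of p] by linarith
  qed
  have near: "\<exists>a b. (\<forall>j<m. q p j \<le> a j \<and> a j \<le> q p j + 1) \<and> (\<forall>j<m. q p j \<le> b j \<and> b j \<le> q p j + 1) \<and>
      pt p a i \<le> g (pt p a) i \<and> g (pt p b) i \<le> pt p b i" if i: "i < m" for p i
  proof -
    obtain r s where r: "\<forall>j<m. q p j \<le> r j \<and> r j \<le> q p j + 1"
      and s: "\<forall>j<m. q p j \<le> s j \<and> s j \<le> q p j + 1" and ne: "l (pt p r) i \<noteq> l (pt p s) i"
      using rs[OF i] by blast
    have "pt p r \<in> hilbert_cube" "pt p s \<in> hilbert_cube"
      using r s by (auto intro: corner_cube)
    moreover consider "l (pt p r) i = 0" "l (pt p s) i = 1" | "l (pt p r) i = 1" "l (pt p s) i = 0"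
      using ne l(1)[of "pt p r" i] l(1)[of "pt p s" i] by linarith
    ultimately show ?thesis
      using r s l(4,5) by metis
  qed
  have "\<forall>p. pt p (q p) \<in> hilbert_cube"
    by (intro allI corner_cube) simp
  then obtain x \<phi> where x: "x \<in> hilbert_cube" and \<phi>: "strict_mono \<phi>"
    and "((\<lambda>p. pt p (q p)) \<circ> \<phi>) \<longlonglongrightarrow> x"
    by (rule seq_compactE[OF compact_imp_seq_compact[OF compact_hilbert_cube]])
  then have lim: "(\<lambda>n. pt (\<phi> n) (q (\<phi> n))) \<longlonglongrightarrow> x"
    by (simp only: comp_def)
  \<comment> \<open>Cell corners are within one mesh width of the base point, so they have the same limit.\<close>
  have corner: "(\<lambda>n. pt (\<phi> n) (a n)) \<longlonglongrightarrow> x"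
    if a: "\<And>n j. j < m \<Longrightarrow> q (\<phi> n) j \<le> a n j \<and> a n j \<le> q (\<phi> n) j + 1" for a
  proof -
    have "(\<lambda>n. pt (\<phi> n) (a n) j) \<longlonglongrightarrow> x j" for j
    proof (cases "j < m")
      case True
      have *: "(\<lambda>n. pt (\<phi> n) (q (\<phi> n)) j) \<longlonglongrightarrow> x j"
        by (rule spec[OF iffD1[OF tendsto_coordinatewise lim]])
      have inv: "(\<lambda>n. 1 / real (Suc (\<phi> n))) \<longlonglongrightarrow> 0"
        by (rule LIMSEQ_subseq_LIMSEQ[OF LIMSEQ_Suc[OF lim_1_over_n] \<phi>, unfolded comp_def])
      have upper: "(\<lambda>n. pt (\<phi> n) (q (\<phi> n)) j + 1 / real (Suc (\<phi> n))) \<longlonglongrightarrow> x j"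
        using tendsto_add[OF * inv] unfolding add_0_right .
      have "pt (\<phi> n) (q (\<phi> n)) j \<le> pt (\<phi> n) (a n) j \<and>
          pt (\<phi> n) (a n) j \<le> pt (\<phi> n) (q (\<phi> n)) j + 1 / real (Suc (\<phi> n))" for n
      proof -
        have "real (q (\<phi> n) j) \<le> real (a n j)" "real (a n j) \<le> real (q (\<phi> n) j) + 1"
          using a[OF True, of n] by linarith+
        then show ?thesis
          using True by (simp add: pt_def divide_right_mono flip: add_divide_distrib)
      qed
      then show ?thesis
        by (intro tendsto_sandwich[OF always_eventually always_eventually * upper]) auto
    next
      case False
      then have eq: "pt p b j = 0" for p b
        by (simp add: pt_def)
      have "(\<lambda>n. pt (\<phi> n) (q (\<phi> n)) j) \<longlonglongrightarrow> x j"
        by (rule spec[OF iffD1[OF tendsto_coordinatewise lim]])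
      then show ?thesis
        unfolding eq .
    qed
    then show ?thesis
      by (rule iffD2[OF tendsto_coordinatewise, OF allI])
  qed
  have "g x i = x i" if i: "i < m" for i
  proof -
    obtain a b where a: "\<And>p. (\<forall>j<m. q p j \<le> a p j \<and> a p j \<le> q p j + 1)"
      and b: "\<And>p. (\<forall>j<m. q p j \<le> b p j \<and> b p j \<le> q p j + 1)"
      and ab: "\<And>p. pt p (a p) i \<le> g (pt p (a p)) i" "\<And>p. g (pt p (b p)) i \<le> pt p (b p) i"
      using near[OF i] by metis
    have lims: "(\<lambda>n. pt (\<phi> n) (c (\<phi> n)) i) \<longlonglongrightarrow> x i"
        "(\<lambda>n. g (pt (\<phi> n) (c (\<phi> n))) i) \<longlonglongrightarrow> g x i"
      if c: "\<And>p. (\<forall>j<m. q p j \<le> c p j \<and> c p j \<le> q p j + 1)" for c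
    proof -
      have L: "(\<lambda>n. pt (\<phi> n) (c (\<phi> n))) \<longlonglongrightarrow> x"
        using c by (intro corner) auto
      show "(\<lambda>n. pt (\<phi> n) (c (\<phi> n)) i) \<longlonglongrightarrow> x i"
        by (rule spec[OF iffD1[OF tendsto_coordinatewise L]])
      show "(\<lambda>n. g (pt (\<phi> n) (c (\<phi> n))) i) \<longlonglongrightarrow> g x i"
        by (rule continuous_on_tendsto_compose[OF cont[OF i] L x])
          (use c corner_cube in auto)
    qed
    have "x i \<le> g x i"
      by (rule tendsto_le[OF _ lims(2)[of a] lims(1)[of a]]) (use a ab in auto)
    moreover have "g x i \<le> x i"
      by (rule tendsto_le[OF _ lims(1)[of b] lims(2)[of b]]) (use b ab in auto)
    ultimately show ?thesis by simp
  qed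
  with x show thesis by (rule that)
qed

section \<open>Open covers and weights\<close>

text \<open>
  This is the standard simplex with \<open>m\<close> vertices times the set of all nonnegative sequences, the
  latter in the coordinates from \<open>m\<close> on.
\<close>

definition weight_simplex :: "nat \<Rightarrow> (nat \<Rightarrow> real) set" where
  "weight_simplex m = {w. (\<forall>k. 0 \<le> w k) \<and> (\<Sum>k<m. w k) = 1}"

text \<open>
  The pullback of the cover to the simplex has a partition of unity \<open>\<beta>\<close>, and \<open>w \<mapsto> (\<beta> 0 w, \<dots>)\<close> maps the
  simplex into itself. At a fixed point a positive weight \<open>w k\<close> is a positive value of \<open>\<beta> k\<close>, hence
  \<open>h w \<in> W k\<close>. The partition is formed on the simplex, where distances to complements of open sets
  provide it.
\<close>

lemma simplex_open_cover:
  assumes "0 < m"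
    and openW: "\<And>k. k < m \<Longrightarrow> openin T (W k)"
    and cover: "topspace T \<subseteq> (\<Union>k<m. W k)"
    and h: "continuous_map (top_of_set (weight_simplex m)) T h"
  obtains w where "w \<in> weight_simplex m" "\<And>k. k < m \<Longrightarrow> 0 < w k \<Longrightarrow> h w \<in> W k"
proof -
  let ?S = "weight_simplex m"
  have "\<exists>O'. open O' \<and> {w \<in> ?S. h w \<in> W k} = ?S \<inter> O'" if "k < m" for k
    using openin_continuous_map_preimage[OF h openW[OF that]] by (auto simp: openin_open)
  then obtain U where openU: "\<And>k. k < m \<Longrightarrow> open (U k)"
    and U: "\<And>k. k < m \<Longrightarrow> {w \<in> ?S. h w \<in> W k} = ?S \<inter> U k"
    by metis
  \<comment> \<open>The case distinction is forced by the default value \<open>infdist w {} = 0\<close>.\<close>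
  define d where "d k w = (if U k = UNIV then 1 else infdist w (- U k))" for k and w :: "nat \<Rightarrow> real"
  have d_cont: "continuous_on A (d k)" for A k
    unfolding d_def by (cases "U k = UNIV") (auto intro!: continuous_intros)
  have d_nonneg: "0 \<le> d k w" for k w
    by (simp add: d_def infdist_nonneg)
  have d_pos: "0 < d k w \<longleftrightarrow> w \<in> U k" if "k < m" for k w
    using in_closed_iff_infdist_zero[of "- U k" w] openU[OF that] infdist_nonneg[of w "- U k"]
    by (auto simp: d_def order_less_le)
  have sum_pos: "0 < (\<Sum>k<m. d k w)" if "w \<in> ?S" for w
  proof -
    have "h w \<in> topspace T"
      using h that by (auto simp: continuous_map_def)
    then obtain k where "k < m" "h w \<in> W k"
      using cover by blast
    then have "w \<in> U k"
      using U[of k] that by blast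
    then show ?thesis
      using d_pos[of k] d_nonneg \<open>k < m\<close> by (intro sum_pos2[of _ k]) auto
  qed
  define \<beta> where "\<beta> k w = (if k < m then d k w / (\<Sum>j<m. d j w) else 0)" for k w
  have \<beta>_cont: "continuous_on ?S (\<beta> k)" for k
    unfolding \<beta>_def using sum_pos
    by (cases "k < m") (auto intro!: continuous_intros d_cont simp: less_imp_neq[symmetric])
  have \<beta>_nonneg: "0 \<le> \<beta> k w" for k w
    by (simp add: \<beta>_def d_nonneg sum_nonneg)
  have \<beta>_sum: "(\<Sum>k<m. \<beta> k w) = 1" if "w \<in> ?S" for w
    using sum_pos[OF that] by (simp add: \<beta>_def flip: sum_divide_distrib)
  have \<beta>_le: "\<beta> k w \<le> 1" if "w \<in> ?S" for k w
  proof (cases "k < m")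
    case True
    then have "\<beta> k w \<le> (\<Sum>k<m. \<beta> k w)"
      by (intro member_le_sum) (auto simp: \<beta>_nonneg)
    then show ?thesis
      using \<beta>_sum[OF that] by simp
  qed (simp add: \<beta>_def)
  \<comment> \<open>A retraction of the cube onto the simplex: a defect of the coordinate sum is spread evenly,
    an excess is scaled away.\<close>
  define \<rho> :: "(nat \<Rightarrow> real) \<Rightarrow> nat \<Rightarrow> real" where
    "\<rho> x = (\<lambda>k. (x k + max 0 (1 - (\<Sum>j<m. x j)) / m) / max 1 (\<Sum>j<m. x j))" for x
  have \<rho>_in: "\<rho> x \<in> ?S" if "x \<in> hilbert_cube" for x
  proof -
    have "(\<Sum>k<m. \<rho> x k) = ((\<Sum>j<m. x j) + max 0 (1 - (\<Sum>j<m. x j))) / max 1 (\<Sum>j<m. x j)"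
      using \<open>0 < m\<close> by (simp add: \<rho>_def sum.distrib flip: sum_divide_distrib)
    also have "\<dots> = 1"
      by (auto simp: max_def)
    finally show ?thesis
      using that by (auto simp: weight_simplex_def \<rho>_def hilbert_cube_def)
  qed
  have \<rho>_id: "\<rho> x = x" if "(\<Sum>k<m. x k) = 1" for x
    using that by (simp add: \<rho>_def)
  have coord: "continuous_on A (\<lambda>x. x j)" for A :: "(nat \<Rightarrow> real) set" and j
    by (rule continuous_on_subset[OF continuous_on_product_coordinates]) simp
  have \<rho>_cont: "continuous_on A \<rho>" for A
  proof (rule continuous_on_coordinatewise_then_product)
    have "continuous_on A (\<lambda>x. \<Sum>j<m. x j)"
      by (rule continuous_on_sum) (rule coord)
    then show "continuous_on A (\<lambda>x. \<rho> x k)" for k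
      unfolding \<rho>_def
      by (intro continuous_on_divide continuous_on_add continuous_on_max continuous_on_diff
          continuous_on_const coord) (use \<open>0 < m\<close> in auto)
  qed
  obtain x where x: "x \<in> hilbert_cube" and fix_x: "\<And>k. k < m \<Longrightarrow> \<beta> k (\<rho> x) = x k"
  proof (rule brouwer_coordinates[of m "\<lambda>x k. \<beta> k (\<rho> x)"])
    show "continuous_on hilbert_cube (\<lambda>x. \<beta> k (\<rho> x))" for k
      by (rule continuous_on_compose2[OF \<beta>_cont \<rho>_cont]) (use \<rho>_in in auto)
    show "(\<lambda>k. \<beta> k (\<rho> x)) \<in> hilbert_cube" if "x \<in> hilbert_cube" for x
      using \<beta>_nonneg \<beta>_le \<rho>_in[OF that] by (auto simp: hilbert_cube_def)
  qed (use that in auto)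
  have "(\<Sum>k<m. x k) = 1"
    using \<beta>_sum[OF \<rho>_in[OF x]] fix_x by simp
  then have \<rho>x: "\<rho> x = x" and xS: "x \<in> ?S"
    using \<rho>_id \<rho>_in[OF x] by auto
  have "h x \<in> W k" if k: "k < m" and "0 < x k" for k
  proof -
    have "0 < d k x"
      using fix_x[OF k] \<open>0 < x k\<close> k \<rho>x d_nonneg[of k x] by (auto simp: \<beta>_def order_less_le)
    then show ?thesis
      using d_pos[OF k] U[OF k] xS by blast
  qed
  with xS show thesis by (rule that)
qed

section \<open>Continuity of linear operations\<close>

lemma tvs_add_closed: "tvs T \<Longrightarrow> x \<in> topspace T \<Longrightarrow> y \<in> topspace T \<Longrightarrow> x + y \<in> topspace T"
  by (simp add: tvs_def subspace_add)

lemma tvs_scale_closed: "tvs T \<Longrightarrow> x \<in> topspace T \<Longrightarrow> c *\<^sub>R x \<in> topspace T"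
  by (simp add: tvs_def subspace_scale)

lemma tvs_zero_mem: "tvs T \<Longrightarrow> 0 \<in> topspace T"
  by (simp add: tvs_def subspace_0)

lemma tvs_continuous_map_add:
  assumes "tvs T" "continuous_map Z T g" "continuous_map Z T h"
  shows "continuous_map Z T (\<lambda>z. g z + h z)"
proof -
  have "continuous_map Z T ((\<lambda>(x, y). x + y) \<circ> (\<lambda>z. (g z, h z)))"
    using assms by (intro continuous_map_compose[of _ "prod_topology T T"] continuous_map_pairedI)
      (auto simp: tvs_def)
  then show ?thesis
    by (simp add: comp_def)
qed

lemma tvs_continuous_map_scale:
  assumes "tvs T" "continuous_map Z euclideanreal c" "continuous_map Z T g"
  shows "continuous_map Z T (\<lambda>z. c z *\<^sub>R g z)"
proof -
  have "continuous_map Z T ((\<lambda>(c, x). c *\<^sub>R x) \<circ> (\<lambda>z. (c z, g z)))"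
    using assms by (intro continuous_map_compose[of _ "prod_topology euclideanreal T"] continuous_map_pairedI)
      (auto simp: tvs_def)
  then show ?thesis
    by (simp add: comp_def)
qed

lemma tvs_continuous_map_sum:
  assumes "tvs T" "finite K" "\<And>k. k \<in> K \<Longrightarrow> continuous_map Z T (g k)"
  shows "continuous_map Z T (\<lambda>z. \<Sum>k\<in>K. g k z)"
  using assms(2,3)
  by (induction K rule: finite_induct)
    (auto intro!: tvs_continuous_map_add[OF assms(1)] simp: tvs_zero_mem[OF assms(1)])

lemma tvs_prod_topology:
  assumes "tvs S" "tvs T"
  shows "tvs (prod_topology S T)"
proof -
  let ?P = "prod_topology S T"
  have fst': "continuous_map Z S (\<lambda>z. fst (g z))" and snd': "continuous_map Z T (\<lambda>z. snd (g z))"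
    if "continuous_map Z ?P g" for Z :: "'c topology" and g
    using continuous_map_fst_of[OF that] continuous_map_snd_of[OF that] by (simp_all add: comp_def)
  have "subspace (topspace S \<times> topspace T)"
    using assms by (auto simp: tvs_def intro: subspace_Times)
  moreover have "continuous_map (prod_topology ?P ?P) ?P (\<lambda>p. (fst (fst p) + fst (snd p), snd (fst p) + snd (snd p)))"
    by (intro continuous_map_pairedI tvs_continuous_map_add assms fst' snd'
        continuous_map_fst continuous_map_snd)
  moreover have "continuous_map (prod_topology euclideanreal ?P) ?P (\<lambda>p. (fst p *\<^sub>R fst (snd p), fst p *\<^sub>R snd (snd p)))"
    by (intro continuous_map_pairedI tvs_continuous_map_scale assms fst' snd'
        continuous_map_fst continuous_map_snd)
  ultimately show ?thesis
    by (simp add: tvs_def case_prod_unfold plus_prod_def scaleR_prod_def)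
qed

section \<open>A fixed point theorem of Browder type on products\<close>

text \<open>
  By compactness, finitely many profiles \<open>c\<close> suffice for the open sets
  \<open>W c = {z. \<forall>i. c i \<in> P i z}\<close> to cover the product. Weighted averages of these profiles
  are parametrised by a simplex, and the open cover lemma gives an average \<open>h w\<close> such that every
  profile of positive weight belongs to \<open>P i (h w)\<close> for all \<open>i\<close>. By convexity so does \<open>h w\<close> itself.
  Convexity is imposed factor by factor because extensional profiles do not form a vector space.
\<close>

lemma browder_product:
  fixes E :: "'i \<Rightarrow> 'e::real_vector topology"
  assumes fin: "finite I"
    and E: "\<And>i. i \<in> I \<Longrightarrow> tvs (E i)"
    and X: "\<And>i. i \<in> I \<Longrightarrow> X i \<noteq> {} \<and> convex (X i) \<and> compactin (E i) (X i)"
    and P: "\<And>i z. i \<in> I \<Longrightarrow> z \<in> Pi\<^sub>E I X \<Longrightarrow> P i z \<noteq> {} \<and> convex (P i z) \<and> P i z \<subseteq> X i"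
    and P_open: "\<And>i. i \<in> I \<Longrightarrow>
      open_lower_sections (product_topology (\<lambda>j. subtopology (E j) (X j)) I) (subtopology (E i) (X i)) (P i)"
  shows "\<exists>z\<in>Pi\<^sub>E I X. \<forall>i\<in>I. z i \<in> P i z"
proof -
  let ?T = "product_topology (\<lambda>j. subtopology (E j) (X j)) I"
  have X_sub: "X i \<subseteq> topspace (E i)" if "i \<in> I" for i
    using X[OF that] compactin_subset_topspace by blast
  have topX: "topspace (subtopology (E i) (X i)) = X i" if "i \<in> I" for i
    using X_sub[OF that] by auto
  have topT: "topspace ?T = Pi\<^sub>E I X"
    unfolding topspace_product_topology by (rule PiE_cong) (simp add: topX del: topspace_subtopology)
  have compT: "compact_space ?T"
    using X by (auto simp: compact_space_product_topology compact_space_subtopology)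
  define W where "W c = {z \<in> Pi\<^sub>E I X. \<forall>i\<in>I. c i \<in> P i z}" for c
  have W_open: "openin ?T (W c)" if "c \<in> Pi\<^sub>E I X" for c
  proof -
    have "openin ?T ((\<Inter>i\<in>I. {z \<in> topspace ?T. c i \<in> P i z}) \<inter> topspace ?T)"
    proof (intro openin_INT fin)
      fix i assume i: "i \<in> I"
      show "openin ?T {z \<in> topspace ?T. c i \<in> P i z}"
        using P_open[OF i] PiE_mem[OF that i] unfolding open_lower_sections_def topX[OF i] by blast
    qed
    moreover have "(\<Inter>i\<in>I. {z \<in> topspace ?T. c i \<in> P i z}) \<inter> topspace ?T = W c"
      unfolding W_def topT by blast
    ultimately show ?thesis by simp
  qed
  have covered: "\<exists>c\<in>Pi\<^sub>E I X. z \<in> W c" if z: "z \<in> Pi\<^sub>E I X" for z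
  proof -
    have "\<forall>i\<in>I. \<exists>a. a \<in> P i z"
      using P[OF _ z] by blast
    then obtain c where c: "\<forall>i\<in>I. c i \<in> P i z"
      by (rule bchoice[THEN exE])
    then have "restrict c I \<in> Pi\<^sub>E I X"
      using P[OF _ z] by (intro restrict_PiE_iff[THEN iffD2]) blast
    moreover have "z \<in> W (restrict c I)"
      using c z by (simp add: W_def)
    ultimately show ?thesis by blast
  qed
  obtain \<F> where "finite \<F>" "\<F> \<subseteq> W ` Pi\<^sub>E I X" "Pi\<^sub>E I X \<subseteq> \<Union>\<F>"
  proof -
    have "\<And>U. U \<in> W ` Pi\<^sub>E I X \<Longrightarrow> openin ?T U" "Pi\<^sub>E I X \<subseteq> \<Union>(W ` Pi\<^sub>E I X)"
      using W_open covered by auto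
    then show thesis
      using compT that unfolding compact_space_def compactin_def topT by meson
  qed
  then obtain Z where Z: "finite Z" "Z \<subseteq> Pi\<^sub>E I X" "Pi\<^sub>E I X \<subseteq> (\<Union>c\<in>Z. W c)"
    by (metis finite_subset_image)
  obtain e where e: "bij_betw e {..<card Z} Z"
    using ex_bij_betw_nat_finite[OF \<open>finite Z\<close>] by (auto simp: atLeast0LessThan)
  let ?m = "card Z"
  have e_in: "e k \<in> Pi\<^sub>E I X" if "k < ?m" for k
    using e Z(2) that by (auto simp: bij_betw_def)
  have "Pi\<^sub>E I X \<noteq> {}"
    using X by (simp add: PiE_eq_empty_iff)
  then have "0 < ?m"
    using Z by (auto simp: card_gt_0_iff)
  define h where "h w = (\<lambda>i\<in>I. \<Sum>k<?m. w k *\<^sub>R e k i)" for w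
  have h_cont: "continuous_map (top_of_set (weight_simplex ?m)) ?T h"
    unfolding continuous_map_componentwise
  proof (intro conjI ballI)
    show "h ` topspace (top_of_set (weight_simplex ?m)) \<subseteq> extensional I"
      by (auto simp: h_def)
    fix i assume i: "i \<in> I"
    have "continuous_map (top_of_set (weight_simplex ?m)) (subtopology (E i) (X i))
        (\<lambda>w. \<Sum>k<?m. w k *\<^sub>R e k i)"
    proof (rule continuous_map_into_subtopology)
      have "continuous_on (weight_simplex ?m) (\<lambda>w. w k)" for k
        by (rule continuous_on_subset[OF continuous_on_product_coordinates]) simp
      then show "continuous_map (top_of_set (weight_simplex ?m)) (E i) (\<lambda>w. \<Sum>k<?m. w k *\<^sub>R e k i)"
        using e_in X_sub[OF i] i
        by (intro tvs_continuous_map_sum tvs_continuous_map_scale E[OF i]) (auto simp: PiE_iff)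
      show "(\<lambda>w. \<Sum>k<?m. w k *\<^sub>R e k i) \<in> topspace (top_of_set (weight_simplex ?m)) \<rightarrow> X i"
        using X[OF i] e_in i by (auto simp: weight_simplex_def PiE_iff intro!: convex_sum)
    qed
    then show "continuous_map (top_of_set (weight_simplex ?m)) (subtopology (E i) (X i)) (\<lambda>w. h w i)"
      using i by (simp add: h_def)
  qed
  obtain w where w: "w \<in> weight_simplex ?m" and hw: "\<And>k. k < ?m \<Longrightarrow> 0 < w k \<Longrightarrow> h w \<in> W (e k)"
  proof (rule simplex_open_cover[OF \<open>0 < ?m\<close> _ _ h_cont, of "\<lambda>k. W (e k)"])
    show "topspace ?T \<subseteq> (\<Union>k<?m. W (e k))"
    proof
      fix z assume "z \<in> topspace ?T"
      then obtain c where "c \<in> Z" "z \<in> W c"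
        using Z(3) topT by blast
      then show "z \<in> (\<Union>k<?m. W (e k))"
        using bij_betw_imp_surj_on[OF e] by (metis UN_I imageE)
    qed
  qed (use W_open e_in in auto)
  have hw_in: "h w \<in> Pi\<^sub>E I X"
    using h_cont w topT by (auto simp: continuous_map_def)
  moreover have "h w i \<in> P i (h w)" if i: "i \<in> I" for i
  proof -
    \<comment> \<open>Only the vertices of positive weight are known to lie in the convex set \<open>P i (h w)\<close>.\<close>
    let ?K = "{k \<in> {..<?m}. 0 < w k}"
    have pos: "0 < w k \<longleftrightarrow> w k \<noteq> 0" for k
      using w by (auto simp: weight_simplex_def order_less_le)
    have eq: "(\<Sum>k<?m. w k *\<^sub>R e k i) = (\<Sum>k\<in>?K. w k *\<^sub>R e k i)" "(\<Sum>k<?m. w k) = (\<Sum>k\<in>?K. w k)"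
      by (intro sum.mono_neutral_right; force simp: pos)+
    have "(\<Sum>k\<in>?K. w k *\<^sub>R e k i) \<in> P i (h w)"
      using P[OF i hw_in] w hw i eq(2)
      by (intro convex_sum) (auto simp: weight_simplex_def W_def)
    then show ?thesis
      using i eq(1) by (simp add: h_def)
  qed
  ultimately show ?thesis by blast
qed

section \<open>Upper semicontinuous families of cones\<close>

text \<open>
  Upper semicontinuity of a cone-valued map is far stronger than it looks. If \<open>e\<close> is interior to
  \<open>C x0\<close>, then \<open>- e + int (C x0)\<close> is an open set around \<open>C x0\<close>, so it contains \<open>C x\<close> for \<open>x\<close>
  near \<open>x0\<close>. For \<open>v \<in> C x\<close> all multiples \<open>v / s\<close> are in \<open>C x\<close> as well, whence \<open>v / s + e \<in> C x0\<close> and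
  \<open>v + s e \<in> C x0\<close>. Letting \<open>s\<close> tend to \<open>0\<close> gives \<open>v \<in> C x0\<close>.
\<close>

lemma upper_semicontinuous_cone_locally_contained:
  assumes Y: "tvs Y"
    and usc: "upper_semicontinuous M Y C"
    and cone: "\<And>x. x \<in> topspace M \<Longrightarrow> cone (C x) \<and> C x \<subseteq> topspace Y"
    and x0: "x0 \<in> topspace M"
    and C0: "closedin Y (C x0)" "convex (C x0)" "Y interior_of C x0 \<noteq> {}"
  obtains V where "openin M V" "x0 \<in> V" "\<And>x. x \<in> V \<Longrightarrow> C x \<subseteq> C x0"
proof -
  let ?int = "Y interior_of C x0"
  obtain e where e: "e \<in> ?int"
    using C0(3) by blast
  have eY: "e \<in> topspace Y"
    by (rule subsetD[OF interior_of_subset_topspace e])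
  have C0_add: "a + b \<in> C x0" if "a \<in> C x0" "b \<in> C x0" for a b
    using that cone[OF x0] C0(2) convex_cone by blast
  have C0_sub: "C x0 \<subseteq> topspace Y"
    using C0(1) closedin_subset by blast
  define O' where "O' = {v \<in> topspace Y. v + e \<in> ?int}"
  have "openin Y O'"
    unfolding O'_def using Y eY
    by (intro openin_continuous_map_preimage[where Y = Y] tvs_continuous_map_add) auto
  moreover have "C x0 \<subseteq> O'"
  proof
    fix c assume c: "c \<in> C x0"
    then have cY: "c \<in> topspace Y"
      using C0_sub by blast
    have mcY: "- c \<in> topspace Y"
      using tvs_scale_closed[OF Y cY, of "-1"] by simp
    have "openin Y {v \<in> topspace Y. v + - c \<in> ?int}"
      using Y mcY by (intro openin_continuous_map_preimage[where Y = Y] tvs_continuous_map_add) auto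
    moreover have "{v \<in> topspace Y. v + - c \<in> ?int} \<subseteq> C x0"
    proof clarify
      fix v assume "v + - c \<in> ?int"
      then have "(v + - c) + c \<in> C x0"
        using interior_of_subset[of Y "C x0"] c by (blast intro: C0_add)
      then show "v \<in> C x0" by simp
    qed
    ultimately have "{v \<in> topspace Y. v + - c \<in> ?int} \<subseteq> ?int"
      by (rule interior_of_maximal[rotated])
    moreover have "c + e \<in> {v \<in> topspace Y. v + - c \<in> ?int}"
      using e tvs_add_closed[OF Y cY eY] by simp
    ultimately show "c \<in> O'"
      using cY by (auto simp: O'_def)
  qed
  ultimately obtain V where V: "openin M V" "x0 \<in> V" "\<And>x. x \<in> V \<Longrightarrow> C x \<subseteq> O'"
    using usc x0 unfolding upper_semicontinuous_def by metis
  have "C x \<subseteq> C x0" if x: "x \<in> V" for x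
  proof
    fix v assume v: "v \<in> C x"
    have xM: "x \<in> topspace M"
      using V(1) x openin_subset by blast
    have vY: "v \<in> topspace Y"
      using cone[OF xM] v by blast
    have cont: "continuous_map euclideanreal Y (\<lambda>s. v + s *\<^sub>R e)"
      using Y vY eY by (intro tvs_continuous_map_add tvs_continuous_map_scale) auto
    have "v + s *\<^sub>R e \<in> C x0" if s: "0 < s" for s :: real
    proof -
      have "(1 / s) *\<^sub>R v \<in> C x"
        using cone[OF xM] v s unfolding cone_def by simp
      then have "(1 / s) *\<^sub>R v + e \<in> C x0"
        using V(3)[OF x] interior_of_subset[of Y "C x0"] unfolding O'_def by blast
      then have "s *\<^sub>R ((1 / s) *\<^sub>R v + e) \<in> C x0"
        using cone[OF x0] s unfolding cone_def by simp
      then show ?thesis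
        using s by (simp add: scaleR_add_right)
    qed
    moreover have "closed {s. v + s *\<^sub>R e \<in> C x0}"
      using closedin_continuous_map_preimage[OF cont C0(1)] by simp
    ultimately have "closure {0<..} \<subseteq> {s. v + s *\<^sub>R e \<in> C x0}"
      by (intro closure_minimal) auto
    then show "v \<in> C x0"
      by auto
  qed
  with V(1,2) show thesis by (rule that)
qed

text \<open>
  Disjoint closed subsets of a topological vector space cannot in general be separated by open sets,
  so upper semicontinuity of both maps is not enough by itself. Here the cone nearby lies in the cone
  at the given point, and the complement of minus that one cone is the only open set needed.
\<close>

lemma openin_disjoint_from_cone:
  assumes Y: "tvs Y"
    and G: "upper_semicontinuous T Y G" "\<And>p. p \<in> topspace T \<Longrightarrow> G p \<subseteq> topspace Y"
    and p: "continuous_map T M \<pi>"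
    and C: "upper_semicontinuous M Y C"
      "\<And>x. x \<in> topspace M \<Longrightarrow> proper_closed_convex_cone Y (C x) \<and> Y interior_of C x \<noteq> {}"
  shows "openin T {p \<in> topspace T. G p \<inter> uminus ` C (\<pi> p) = {}}"
proof (subst openin_subopen, intro ballI)
  fix p0 assume "p0 \<in> {p \<in> topspace T. G p \<inter> uminus ` C (\<pi> p) = {}}"
  then have p0: "p0 \<in> topspace T" "G p0 \<inter> uminus ` C (\<pi> p0) = {}" by auto
  have x0: "\<pi> p0 \<in> topspace M"
    using p p0(1) by (auto simp: continuous_map_def)
  have C': "closedin Y (C x)" "convex (C x)" "cone (C x)" "C x \<subseteq> topspace Y" if "x \<in> topspace M" for x
    using C(2)[OF that] closedin_subset unfolding proper_closed_convex_cone_def by auto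
  obtain V where V: "openin M V" "\<pi> p0 \<in> V" "\<And>x. x \<in> V \<Longrightarrow> C x \<subseteq> C (\<pi> p0)"
    using upper_semicontinuous_cone_locally_contained[OF Y C(1) _ x0] C' C(2) x0 by metis
  let ?W = "{v \<in> topspace Y. (-1) *\<^sub>R v \<in> topspace Y - C (\<pi> p0)}"
  have "openin Y ?W"
    using Y C'(1)[OF x0]
    by (intro openin_continuous_map_preimage[where Y = Y] tvs_continuous_map_scale) auto
  moreover have "G p0 \<subseteq> ?W"
  proof
    fix v assume v: "v \<in> G p0"
    then have "v \<in> topspace Y" using G(2)[OF p0(1)] by blast
    moreover have "- v \<notin> C (\<pi> p0)"
      using v p0(2) by (force simp: image_iff)
    ultimately show "v \<in> ?W"
      using tvs_scale_closed[OF Y, of v "-1"] by simp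
  qed
  ultimately obtain N where N: "openin T N" "p0 \<in> N" "\<And>p. p \<in> N \<Longrightarrow> G p \<subseteq> ?W"
    using G(1) p0(1) unfolding upper_semicontinuous_def by metis
  have "openin T {p \<in> N. \<pi> p \<in> V}"
    using openin_continuous_map_preimage_gen[OF p N(1) V(1)] .
  moreover have "{p \<in> N. \<pi> p \<in> V} \<subseteq> {p \<in> topspace T. G p \<inter> uminus ` C (\<pi> p) = {}}"
    using openin_subset[OF N(1)] N(3) V(3) by fastforce
  ultimately show "\<exists>U. openin T U \<and> p0 \<in> U \<and> U \<subseteq> {p \<in> topspace T. G p \<inter> uminus ` C (\<pi> p) = {}}"
    using N(2) V(2) by blast
qed

text \<open>
  A tube lemma: the points violating the condition form the projection of the closed set \<open>K - Q\<close>
  along a compact factor, which is closed.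
\<close>

lemma openin_forall_compact_fibre:
  assumes "compact_space U"
    and K: "closedin (prod_topology S U) K"
    and Q: "openin (prod_topology S U) Q"
  shows "openin S {s \<in> topspace S. \<forall>u. (s, u) \<in> K \<longrightarrow> (s, u) \<in> Q}"
proof -
  have "closedin (prod_topology S U) (K - Q)"
    using K Q by blast
  then have "closedin S (fst ` (K - Q))"
    using Abstract_Topological_Spaces.closed_map_fst[OF assms(1)] unfolding closed_map_def by blast
  then have "openin S (topspace S - fst ` (K - Q))"
    by blast
  moreover have "topspace S - fst ` (K - Q) = {s \<in> topspace S. \<forall>u. (s, u) \<in> K \<longrightarrow> (s, u) \<in> Q}"
    by force
  ultimately show ?thesis by simp
qed

section \<open>The acceptable pairs of a player\<close>

text \<open>
  A value at a convex combination is \<open>g + c\<close> with \<open>g\<close> a value at one of the end points and \<open>c \<in> C\<close>.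
  If it were in \<open>- C\<close>, then \<open>g\<close> would be in \<open>- C - c \<subseteq> - C\<close>.
\<close>

lemma quasi_convex_like_imp_convex_disjoint:
  assumes qc: "quasi_convex_like K (uminus ` C) G"
    and K: "convex K" and C: "convex C" "cone C"
  shows "convex {k \<in> K. G k \<inter> uminus ` C = {}}"
proof (rule convexI)
  fix k1 k2 and s t :: real
  assume k: "k1 \<in> {k \<in> K. G k \<inter> uminus ` C = {}}" "k2 \<in> {k \<in> K. G k \<inter> uminus ` C = {}}"
    and st: "0 \<le> s" "0 \<le> t" "s + t = 1"
  let ?k = "s *\<^sub>R k1 + t *\<^sub>R k2"
  have absorb: "G ?k \<inter> uminus ` C = {}"
    if sub: "G ?k \<subseteq> {g - d | g d. g \<in> G k \<and> d \<in> uminus ` C}" and k: "G k \<inter> uminus ` C = {}" for k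
  proof (rule ccontr)
    assume "G ?k \<inter> uminus ` C \<noteq> {}"
    then obtain c where "c \<in> C" "- c \<in> G ?k" by blast
    then obtain g c' where "g \<in> G k" "c' \<in> C" "- c = g + c'"
      using sub by force
    then have "g = - (c + c')"
      by (simp add: algebra_simps eq_neg_iff_add_eq_0)
    moreover have "c + c' \<in> C"
      using C \<open>c \<in> C\<close> \<open>c' \<in> C\<close> convex_cone by blast
    ultimately show False
      using \<open>g \<in> G k\<close> k by blast
  qed
  have "G (s *\<^sub>R k1 + (1 - s) *\<^sub>R k2) \<subseteq> {g - d | g d. g \<in> G k1 \<and> d \<in> uminus ` C} \<or>
        G (s *\<^sub>R k1 + (1 - s) *\<^sub>R k2) \<subseteq> {g - d | g d. g \<in> G k2 \<and> d \<in> uminus ` C}"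
    using qc k st unfolding quasi_convex_like_def by (metis (no_types, lifting) atLeastAtMost_iff le_add_same_cancel1 mem_Collect_eq)
  moreover have "1 - s = t" using st by simp
  ultimately have "G ?k \<inter> uminus ` C = {}"
    using absorb k by auto
  moreover have "?k \<in> K"
    using K k st by (auto simp: convexD)
  ultimately show "?k \<in> {k \<in> K. G k \<inter> uminus ` C = {}}" by blast
qed

text \<open>
  Here \<open>M\<close> is the space of the opponents' profiles and \<open>G\<close> is the payoff for a fixed own choice
  \<open>(a, b)\<close>. The closure of \<open>A\<close>, rather than \<open>A\<close> itself, is what turns the quantification over \<open>u\<close>
  into one over a closed subset of a compact factor.
\<close>

lemma openin_acceptable_pairs:
  assumes U: "compact_space U" and Y: "tvs Y"
    and A: "open_lower_sections M U A" and F: "open_lower_sections M U F"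
    and G: "upper_semicontinuous (prod_topology M (prod_topology M U)) Y (\<lambda>(x, y, u). G x y u)"
      "\<And>x y u. x \<in> topspace M \<Longrightarrow> y \<in> topspace M \<Longrightarrow> u \<in> topspace U \<Longrightarrow> G x y u \<subseteq> topspace Y"
    and C: "upper_semicontinuous M Y C"
      "\<And>x. x \<in> topspace M \<Longrightarrow> proper_closed_convex_cone Y (C x) \<and> Y interior_of C x \<noteq> {}"
    and ab: "a \<in> topspace U" "b \<in> topspace U"
  shows "openin (prod_topology M M) {p \<in> topspace (prod_topology M M).
           a \<in> A (fst p) \<and> b \<in> F (snd p) \<and>
           (\<forall>u\<in>corr_closure M U A (fst p). G (fst p) (snd p) u \<inter> uminus ` C (fst p) = {})}"
proof -
  let ?MM = "prod_topology M M" and ?D = "prod_topology M (prod_topology M U)"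
  let ?\<phi> = "\<lambda>q. (fst (fst q), snd (fst q), snd q)"
  have proj: "continuous_map (prod_topology ?MM U) M (\<lambda>q. fst (fst q))"
      "continuous_map (prod_topology ?MM U) M (\<lambda>q. snd (fst q))"
      "continuous_map (prod_topology ?MM U) U snd"
    using continuous_map_compose[OF continuous_map_fst[of ?MM U] continuous_map_fst]
      continuous_map_compose[OF continuous_map_fst[of ?MM U] continuous_map_snd] continuous_map_snd
    by (simp_all add: comp_def)
  define Q where "Q = {q \<in> topspace (prod_topology ?MM U). ?\<phi> q \<in>
    {d \<in> topspace ?D. (case d of (x, y, u) \<Rightarrow> G x y u) \<inter> uminus ` C (fst d) = {}}}"
  have "openin (prod_topology ?MM U) Q"
    unfolding Q_def
  proof (rule openin_continuous_map_preimage)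
    show "continuous_map (prod_topology ?MM U) ?D ?\<phi>"
      by (intro continuous_map_pairedI proj)
    show "openin ?D {d \<in> topspace ?D. (case d of (x, y, u) \<Rightarrow> G x y u) \<inter> uminus ` C (fst d) = {}}"
      by (rule openin_disjoint_from_cone[OF Y G(1) _ continuous_map_fst C]) (use G(2) in auto)
  qed
  moreover define K where "K = {q \<in> topspace (prod_topology ?MM U).
    (fst (fst q), snd q) \<in> prod_topology M U closure_of corr_graph M U A}"
  have "closedin (prod_topology ?MM U) K"
    unfolding K_def
  proof (rule closedin_continuous_map_preimage)
    show "continuous_map (prod_topology ?MM U) (prod_topology M U) (\<lambda>q. (fst (fst q), snd q))"
      by (intro continuous_map_pairedI proj)
  qed simp
  ultimately have "openin ?MM {p \<in> topspace ?MM. \<forall>u. (p, u) \<in> K \<longrightarrow> (p, u) \<in> Q}"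
    using openin_forall_compact_fibre[OF U] by blast
  moreover have "openin ?MM {p \<in> topspace ?MM. fst p \<in> {x \<in> topspace M. a \<in> A x}}"
    using A ab by (intro openin_continuous_map_preimage[OF continuous_map_fst]) (simp add: open_lower_sections_def)
  moreover have "openin ?MM {p \<in> topspace ?MM. snd p \<in> {x \<in> topspace M. b \<in> F x}}"
    using F ab by (intro openin_continuous_map_preimage[OF continuous_map_snd]) (simp add: open_lower_sections_def)
  ultimately have "openin ?MM ({p \<in> topspace ?MM. \<forall>u. (p, u) \<in> K \<longrightarrow> (p, u) \<in> Q} \<inter>
      {p \<in> topspace ?MM. fst p \<in> {x \<in> topspace M. a \<in> A x}} \<inter>
      {p \<in> topspace ?MM. snd p \<in> {x \<in> topspace M. b \<in> F x}})"
    by (intro openin_Int)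
  also have "{p \<in> topspace ?MM. \<forall>u. (p, u) \<in> K \<longrightarrow> (p, u) \<in> Q} \<inter>
      {p \<in> topspace ?MM. fst p \<in> {x \<in> topspace M. a \<in> A x}} \<inter>
      {p \<in> topspace ?MM. snd p \<in> {x \<in> topspace M. b \<in> F x}} =
    {p \<in> topspace ?MM. a \<in> A (fst p) \<and> b \<in> F (snd p) \<and>
      (\<forall>u\<in>corr_closure M U A (fst p). G (fst p) (snd p) u \<inter> uminus ` C (fst p) = {})}"
    by (auto simp: K_def Q_def corr_closure_def)
  finally show ?thesis .
qed

section \<open>Existence of an equilibrium pair\<close>

theorem theorem10:
  fixes n :: nat
    and E :: "nat \<Rightarrow> 'e::real_vector topology"
    and Y :: "nat \<Rightarrow> 'y::real_vector topology"
    and X :: "nat \<Rightarrow> 'e set"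
    and A F :: "nat \<Rightarrow> (nat \<Rightarrow> 'e) \<Rightarrow> 'e set"
    and C :: "nat \<Rightarrow> (nat \<Rightarrow> 'e) \<Rightarrow> 'y set"
    and f :: "nat \<Rightarrow> (nat \<Rightarrow> 'e) \<Rightarrow> (nat \<Rightarrow> 'e) \<Rightarrow> 'e \<Rightarrow> 'y set"
  assumes E: "\<And>i. i \<in> {1..n} \<Longrightarrow> locally_convex_tvs (E i) \<and> Hausdorff_space (E i)"
    and Y: "\<And>i. i \<in> {1..n} \<Longrightarrow> tvs (Y i)"
    and X: "\<And>i. i \<in> {1..n} \<Longrightarrow> X i \<noteq> {} \<and> convex (X i) \<and> compactin (E i) (X i)"
    and A_corr: "\<And>i. i \<in> {1..n} \<Longrightarrow>
          correspondence (prof_topology E X ({1..n} - {i})) (subtopology (E i) (X i)) (A i)"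
    and F_corr: "\<And>i. i \<in> {1..n} \<Longrightarrow>
          correspondence (prof_topology E X ({1..n} - {i})) (subtopology (E i) (X i)) (F i)"
    and C_corr: "\<And>i. i \<in> {1..n} \<Longrightarrow>
          correspondence (prof_topology E X ({1..n} - {i})) (Y i) (C i)"
    and C_cone: "\<And>i xm. \<lbrakk>i \<in> {1..n}; xm \<in> prof X ({1..n} - {i})\<rbrakk> \<Longrightarrow>
          proper_closed_convex_cone (Y i) (C i xm) \<and> Y i interior_of C i xm \<noteq> {}"
    and f_values: "\<And>i x y u. \<lbrakk>i \<in> {1..n}; x \<in> prof X {1..n}; y \<in> prof X {1..n}; u \<in> X i\<rbrakk> \<Longrightarrow>
          f i x y u \<noteq> {} \<and> closedin (Y i) (f i x y u)"
    and a_A: "\<And>i xm. \<lbrakk>i \<in> {1..n}; xm \<in> prof X ({1..n} - {i})\<rbrakk> \<Longrightarrow>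
          A i xm \<noteq> {} \<and> convex (A i xm)"
    and a_A_open: "\<And>i. i \<in> {1..n} \<Longrightarrow>
          open_lower_sections (prof_topology E X ({1..n} - {i})) (subtopology (E i) (X i)) (A i)"
    and a_F: "\<And>i xm. \<lbrakk>i \<in> {1..n}; xm \<in> prof X ({1..n} - {i})\<rbrakk> \<Longrightarrow>
          F i xm \<noteq> {} \<and> convex (F i xm)"
    and a_F_open: "\<And>i. i \<in> {1..n} \<Longrightarrow>
          open_lower_sections (prof_topology E X ({1..n} - {i})) (subtopology (E i) (X i)) (F i)"
    and b: "\<And>i xi yi. \<lbrakk>i \<in> {1..n}; xi \<in> X i; yi \<in> X i\<rbrakk> \<Longrightarrow>
          upper_semicontinuous
            (prod_topology (prof_topology E X ({1..n} - {i}))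
              (prod_topology (prof_topology E X ({1..n} - {i})) (subtopology (E i) (X i))))
            (Y i)
            (\<lambda>(xm, ym, u). f i (xm(i := xi)) (ym(i := yi)) u)"
    and c: "\<And>i. i \<in> {1..n} \<Longrightarrow>
          upper_semicontinuous (prof_topology E X ({1..n} - {i})) (Y i) (C i)"
    and d: "\<And>i xm ym. \<lbrakk>i \<in> {1..n}; xm \<in> prof X ({1..n} - {i}); ym \<in> prof X ({1..n} - {i})\<rbrakk> \<Longrightarrow>
          \<exists>xi\<in>A i xm. \<exists>yi\<in>F i ym.
            \<forall>u\<in>corr_closure (prof_topology E X ({1..n} - {i})) (subtopology (E i) (X i)) (A i) xm.
              f i (xm(i := xi)) (ym(i := yi)) u \<inter> uminus ` C i xm = {}"
    and e: "\<And>i xm ym u. \<lbrakk>i \<in> {1..n}; xm \<in> prof X ({1..n} - {i}); ym \<in> prof X ({1..n} - {i});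
            u \<in> X i\<rbrakk> \<Longrightarrow>
          quasi_convex_like (X i \<times> X i) (uminus ` C i xm)
            (\<lambda>(xi, yi). f i (xm(i := xi)) (ym(i := yi)) u)"
  shows "\<exists>x\<in>prof X {1..n}. \<exists>y\<in>prof X {1..n}. \<forall>i\<in>{1..n}.
           x i \<in> A i (restrict x ({1..n} - {i})) \<and>
           y i \<in> F i (restrict y ({1..n} - {i})) \<and>
           (\<forall>u\<in>A i (restrict x ({1..n} - {i})).
              f i x y u \<inter> uminus ` (Y i interior_of C i (restrict x ({1..n} - {i}))) = {})"
proof -
  let ?N = "{1..n}"
  let ?M = "\<lambda>i. prof_topology E X (?N - {i})" and ?U = "\<lambda>i. subtopology (E i) (X i)"
  let ?E2 = "\<lambda>i. prod_topology (E i) (E i)" and ?X2 = "\<lambda>i. X i \<times> X i"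
  let ?T = "product_topology (\<lambda>j. subtopology (?E2 j) (?X2 j)) ?N"
  let ?fst = "\<lambda>J z. \<lambda>j\<in>J. fst (z j)" and ?snd = "\<lambda>J z. \<lambda>j\<in>J. snd (z j)"
  have X_sub: "X i \<subseteq> topspace (E i)" if "i \<in> ?N" for i
    using X[OF that] compactin_subset_topspace by blast
  have topU: "topspace (?U i) = X i" if "i \<in> ?N" for i
    using X_sub[OF that] by auto
  have topM: "topspace (?M i) = prof X (?N - {i})" for i
    unfolding topspace_product_topology by (rule PiE_cong) (simp add: topU del: topspace_subtopology)
  have topT: "topspace ?T = prof ?X2 ?N"
    unfolding topspace_product_topology using X_sub by (intro PiE_cong) auto
  have part_in: "?fst (?N - {i}) z \<in> prof X (?N - {i})" "?snd (?N - {i}) z \<in> prof X (?N - {i})"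
    if "z \<in> prof ?X2 ?N" for i z
    using that by (auto simp: PiE_iff mem_Times_iff)
  have insert_in: "w(i := a) \<in> prof X ?N" if "w \<in> prof X (?N - {i})" "i \<in> ?N" "a \<in> X i" for w i a
    using that by (auto simp: PiE_iff extensional_def)
  have A_sub: "A i w \<subseteq> X i" and F_sub: "F i w \<subseteq> X i"
    if "i \<in> ?N" "w \<in> prof X (?N - {i})" for i w
    using A_corr[OF that(1)] F_corr[OF that(1)] that(2)
    unfolding correspondence_def topM topU[OF that(1)] by blast+
  have cone: "convex (C i w)" "cone (C i w)" if "i \<in> ?N" "w \<in> prof X (?N - {i})" for i w
    using C_cone[OF that] by (auto simp: proper_closed_convex_cone_def)
  \<comment> \<open>The two profiles are treated as one profile of pairs, since the condition couples the own
    choices \<open>x i\<close> and \<open>y i\<close>.\<close>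
  define P where "P i z = {k \<in> ?X2 i. fst k \<in> A i (?fst (?N - {i}) z) \<and> snd k \<in> F i (?snd (?N - {i}) z) \<and>
      (\<forall>u\<in>corr_closure (?M i) (?U i) (A i) (?fst (?N - {i}) z).
         f i ((?fst (?N - {i}) z)(i := fst k)) ((?snd (?N - {i}) z)(i := snd k)) u \<inter>
           uminus ` C i (?fst (?N - {i}) z) = {})}" for i z
  have "\<exists>z\<in>prof ?X2 ?N. \<forall>i\<in>?N. z i \<in> P i z"
  proof (rule browder_product[of ?N ?E2])
    show "tvs (?E2 i)" if "i \<in> ?N" for i
      using E[OF that] by (auto simp: locally_convex_tvs_def intro: tvs_prod_topology)
    show "?X2 i \<noteq> {} \<and> convex (?X2 i) \<and> compactin (?E2 i) (?X2 i)" if "i \<in> ?N" for i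
      using X[OF that] by (auto simp: compactin_Times intro: convex_Times)
    show "P i z \<noteq> {} \<and> convex (P i z) \<and> P i z \<subseteq> ?X2 i" if i: "i \<in> ?N" and z: "z \<in> prof ?X2 ?N" for i z
    proof (intro conjI)
      let ?xm = "?fst (?N - {i}) z" and ?ym = "?snd (?N - {i}) z"
      let ?cl = "corr_closure (?M i) (?U i) (A i) ?xm"
      note xy = part_in[OF z, of i]
      obtain a b where ab: "a \<in> A i ?xm" "b \<in> F i ?ym"
          "\<And>u. u \<in> ?cl \<Longrightarrow> f i (?xm(i := a)) (?ym(i := b)) u \<inter> uminus ` C i ?xm = {}"
        using d[OF i xy] by blast
      then have "(a, b) \<in> P i z"
        using A_sub[OF i xy(1)] F_sub[OF i xy(2)] unfolding P_def by auto
      then show "P i z \<noteq> {}" by blast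
      have cl_sub: "?cl \<subseteq> X i"
        unfolding corr_closure_def topU[OF i] by blast
      have eq: "P i z = ?X2 i \<inter> (A i ?xm \<times> F i ?ym) \<inter> (\<Inter>u\<in>?cl. {k \<in> ?X2 i.
          (case k of (xi, yi) \<Rightarrow> f i (?xm(i := xi)) (?ym(i := yi)) u) \<inter> uminus ` C i ?xm = {}})"
        unfolding P_def by (auto simp: case_prod_unfold)
      have "convex {k \<in> ?X2 i.
          (case k of (xi, yi) \<Rightarrow> f i (?xm(i := xi)) (?ym(i := yi)) u) \<inter> uminus ` C i ?xm = {}}"
        if "u \<in> ?cl" for u
        using e[OF i xy] cl_sub that X[OF i] cone[OF i xy(1)]
        by (intro quasi_convex_like_imp_convex_disjoint convex_Times) auto
      then show "convex (P i z)"
        unfolding eq using X[OF i] a_A[OF i xy(1)] a_F[OF i xy(2)]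
        by (intro convex_Int convex_INT convex_Times) auto
      show "P i z \<subseteq> ?X2 i"
        unfolding P_def by blast
    qed
    show "open_lower_sections ?T (subtopology (?E2 i) (?X2 i)) (P i)" if i: "i \<in> ?N" for i
      unfolding open_lower_sections_def
    proof
      fix k assume "k \<in> topspace (subtopology (?E2 i) (?X2 i))"
      then have k: "fst k \<in> X i" "snd k \<in> X i" "k \<in> ?X2 i" by auto
      let ?J = "?N - {i}"
      let ?O = "{p \<in> topspace (prod_topology (?M i) (?M i)). fst k \<in> A i (fst p) \<and> snd k \<in> F i (snd p) \<and>
           (\<forall>u\<in>corr_closure (?M i) (?U i) (A i) (fst p).
              f i ((fst p)(i := fst k)) ((snd p)(i := snd k)) u \<inter> uminus ` C i (fst p) = {})}"
      have "openin (prod_topology (?M i) (?M i)) ?O"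
      proof (rule openin_acceptable_pairs[where Y = "Y i"])
        show "compact_space (?U i)"
          using X[OF i] by (simp add: compact_space_subtopology)
        show "f i (x(i := fst k)) (y(i := snd k)) u \<subseteq> topspace (Y i)"
          if "x \<in> topspace (?M i)" "y \<in> topspace (?M i)" "u \<in> topspace (?U i)" for x y u
          using that unfolding topM topU[OF i]
          by (intro closedin_subset[OF conjunct2[OF f_values]] i insert_in k)
        show "proper_closed_convex_cone (Y i) (C i x) \<and> Y i interior_of C i x \<noteq> {}"
          if "x \<in> topspace (?M i)" for x
          by (rule C_cone[OF i that[unfolded topM]])
        show "fst k \<in> topspace (?U i)" "snd k \<in> topspace (?U i)"
          unfolding topU[OF i] by (fact k)+
      qed (fact Y[OF i] a_A_open[OF i] a_F_open[OF i] b[OF i k(1,2)] c[OF i])+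
      moreover have "continuous_map ?T (prod_topology (?M i) (?M i)) (\<lambda>z. (?fst ?J z, ?snd ?J z))"
      proof (intro continuous_map_pairedI)
        have proj: "continuous_map ?T (prod_topology (?U j) (?U j)) (\<lambda>z. z j)" if "j \<in> ?N" for j
          using continuous_map_product_projection[OF that, of "\<lambda>j. subtopology (?E2 j) (?X2 j)"]
          by (simp add: subtopology_Times)
        show "continuous_map ?T (?M i) (?fst ?J)" "continuous_map ?T (?M i) (?snd ?J)"
          using continuous_map_fst_of[OF proj] continuous_map_snd_of[OF proj]
          by (auto simp: continuous_map_componentwise comp_def)
      qed
      ultimately have "openin ?T {z \<in> topspace ?T. (?fst ?J z, ?snd ?J z) \<in> ?O}"
        by (rule openin_continuous_map_preimage[rotated])
      also have "{z \<in> topspace ?T. (?fst ?J z, ?snd ?J z) \<in> ?O} = {z \<in> topspace ?T. k \<in> P i z}"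
      proof (intro Collect_cong conj_cong refl)
        fix z assume "z \<in> topspace ?T"
        then have zX: "z \<in> prof ?X2 ?N"
          unfolding topT .
        have "(?fst ?J z, ?snd ?J z) \<in> topspace (prod_topology (?M i) (?M i))"
          unfolding topspace_prod_topology topM by (intro SigmaI part_in zX)
        then show "(?fst ?J z, ?snd ?J z) \<in> ?O \<longleftrightarrow> k \<in> P i z"
          using k(3) unfolding P_def mem_Collect_eq fst_conv snd_conv by blast
      qed
      finally show "openin ?T {z \<in> topspace ?T. k \<in> P i z}" .
    qed
  qed simp
  then obtain z where z: "z \<in> prof ?X2 ?N" and fixed: "\<And>i. i \<in> ?N \<Longrightarrow> z i \<in> P i z"
    by blast
  define x y where "x = ?fst ?N z" and "y = ?snd ?N z"
  have "x \<in> prof X ?N" "y \<in> prof X ?N"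
    using z by (auto simp: x_def y_def PiE_iff mem_Times_iff)
  moreover have "x i \<in> A i (restrict x (?N - {i})) \<and> y i \<in> F i (restrict y (?N - {i})) \<and>
      (\<forall>u\<in>A i (restrict x (?N - {i})).
         f i x y u \<inter> uminus ` (Y i interior_of C i (restrict x (?N - {i}))) = {})" if i: "i \<in> ?N" for i
  proof -
    let ?xm = "restrict x (?N - {i})" and ?ym = "restrict y (?N - {i})"
    have parts: "?fst (?N - {i}) z = ?xm" "?snd (?N - {i}) z = ?ym"
      by (auto simp: x_def y_def fun_eq_iff)
    have comps: "fst (z i) = x i" "snd (z i) = y i"
      using i by (simp_all add: x_def y_def)
    have whole: "?xm(i := x i) = x" "?ym(i := y i) = y"
      using i by (auto simp: x_def y_def fun_eq_iff)
    have acc: "x i \<in> A i ?xm" "y i \<in> F i ?ym"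
        "\<And>u. u \<in> corr_closure (?M i) (?U i) (A i) ?xm \<Longrightarrow> f i x y u \<inter> uminus ` C i ?xm = {}"
      using fixed[OF i] unfolding P_def parts comps whole mem_Collect_eq by blast+
    have xm: "?xm \<in> prof X (?N - {i})"
      using part_in(1)[OF z, of i] unfolding parts .
    have "A i ?xm \<subseteq> corr_closure (?M i) (?U i) (A i) ?xm"
    proof
      fix u assume u: "u \<in> A i ?xm"
      have "corr_graph (?M i) (?U i) (A i) \<subseteq> topspace (prod_topology (?M i) (?U i))"
        unfolding corr_graph_def topspace_prod_topology by blast
      moreover have "u \<in> topspace (?U i)" "(?xm, u) \<in> corr_graph (?M i) (?U i) (A i)"
        using u A_sub[OF i xm] xm unfolding corr_graph_def topM topU[OF i] by blast+
      ultimately show "u \<in> corr_closure (?M i) (?U i) (A i) ?xm"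
        using closure_of_subset unfolding corr_closure_def by blast
    qed
    then show ?thesis
      using acc interior_of_subset[of "Y i" "C i ?xm"] by blast
  qed
  ultimately show ?thesis by blast
qed

end
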